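(* Let $u^k$ be the $k$-th iterate of the FAS algorithm (full approximation storage scheme with step size $1$, described in the context) and $u^{k+1}={\rm FAS}(u^k)$. Suppose that the space decomposition $\mathcal V=\mathcal V_1+\cdots+\mathcal V_N$ is stable with constant $C_A$ and satisfies the strengthened Cauchy--Schwarz inequality with constant $C_S$, that $E$ is strongly convex with constant $\mu$ and has Lipschitz continuous derivative on $\mathcal B$ with constant $L$, and that the approximation property relating $E$ and the local energies $E_i$ holds with constant $\epsilon<\mu/2$ (all in the sense given in the context). Let $u$ be the minimizer of $E$ over $\mathcal V$. Then $$E(u^{k+1})-E(u)\le\rho\,\bigl(E(u^k)-E(u)\bigr),\qquad \rho=\frac{(C_S+\epsilon)^2C_A^2}{(C_S+\epsilon)^2C_A^2+\mu(\mu-2\epsilon)}.$$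
   Context: $\mathcal V$ is a real Hilbert space with norm $\|\cdot\|_{\mathcal V}$, dual $\mathcal V'$, duality pairing $\langle\cdot,\cdot\rangle$, and dual norm $\|f\|_{\mathcal V'}=\sup_{v\neq0}\langle f,v\rangle/\|v\|_{\mathcal V}$. $E:\mathcal V\to\mathbb R$ is Fréchet differentiable with derivative $E'(v)\in\mathcal V'$. A point $u_0\in\mathcal V$ is fixed, $\mathcal B=\{v\in\mathcal V: E(v)\le E(u_0)\}$, and the iteration starts from $u^0=u_0$. Strong convexity of $E$: there is $\mu>0$ with $\mu\|w-v\|_{\mathcal V}^2\le\langle E'(w)-E'(v),w-v\rangle$ for all $v,w\in\mathcal V$ (then $E$ has a unique global minimizer $u$). Lipschitz derivative of $E$: there is $L$ with $\|E'(w)-E'(v)\|_{\mathcal V'}\le L\|w-v\|_{\mathcal V}$ for all $v,w\in\mathcal B$. Space decomposition: $\mathcal V=\mathcal V_1+\cdots+\mathcal V_N$ with closed subspaces $\mathcal V_i\subseteq\mathcal V$. Stable decomposition: there is $C_A>0$ such that each $v\in\mathcal V$ can be written $v=\sum_{i=1}^Nv_i$, $v_i\in\mathcal V_i$, with $\sum_{i=1}^N\|v_i\|_{\mathcal V}^2\le C_A^2\|v\|_{\mathcal V}^2$. Strengthened Cauchy--Schwarz inequality: there is $C_S>0$ such that for any $w_{i,j}\in\mathcal B$, $u_j\in\mathcal V_j$, $v_i\in\mathcal V_i$ with $w_{i,j}+u_j\in\mathcal B$, $$\sum_{i=1}^N\sum_{j=i+1}^N\langle E'(w_{i,j}+u_j)-E'(w_{i,j}),v_i\rangle\le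 C_S\Bigl(\sum_{i=1}^N\|u_i\|_{\mathcal V}^2\Bigr)^{1/2}\Bigl(\sum_{i=1}^N\|v_i\|_{\mathcal V}^2\Bigr)^{1/2}.$$ Local objects: $R_i:\mathcal V'\to\mathcal V_i'$ is restriction of functionals to $\mathcal V_i$; $Q_i:\mathcal V\to\mathcal V_i$ is a (linear) projection, $Q_iv=v$ for $v\in\mathcal V_i$; $E_i:\mathcal V_i\to\mathbb R$ is Fréchet differentiable. Approximation property: $E$ and each $E_i$ are twice Fréchet differentiable and there is a constant $0<\epsilon<\mu/2$ such that for every $i$, all $w\in\mathcal B$, $\eta_i\in\mathcal V_i$ and all $u_i,v_i\in\mathcal V_i$, $$\bigl|\langle E''(w+\eta_i)u_i,v_i\rangle-\langle E_i''(Q_iw+\eta_i)u_i,v_i\rangle\bigr|\le\epsilon\|u_i\|_{\mathcal V}\|v_i\|_{\mathcal V}.$$ FAS algorithm, $u^{k+1}={\rm FAS}(u^k)$: set $v_0=u^k$. For $i=1,\dots,N$: let $\xi_i=Q_iv_{i-1}$, $\tau_i=E_i'(\xi_i)-R_iE'(v_{i-1})\in\mathcal V_i'$; find $\eta_i\in\mathcal V_i$ with $\langle E_i'(\eta_i),w\rangle=\langle\tau_i,w\rangle$ for all $w\in\mathcal V_i$; set $s_i=\eta_i-\xi_i$ and $v_i=v_{i-1}+s_i$. Finally $u^{k+1}=v_N$. *)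

theory Defs
  imports "HOL-Analysis.Analysis"
begin

text \<open>
  The Hilbert space is a type \<open>'a :: {real_inner, complete_space}\<close>; its dual is
  \<open>'a \<Rightarrow>\<^sub>L real\<close> with the operator norm. The subspaces \<open>V 1, \<dots>, V N\<close> are sets, and a function
  on \<open>V i\<close> is a function on \<open>'a\<close> of which only the values on \<open>V i\<close> are used.
  An element of the dual of \<open>V i\<close> is likewise given by some extension in \<open>'a \<Rightarrow>\<^sub>L real\<close>
  (one exists: compose with the orthogonal projection onto the closed subspace \<open>V i\<close>), and a
  bounded operator from \<open>V i\<close> to its dual by some extension in \<open>'a \<Rightarrow>\<^sub>L ('a \<Rightarrow>\<^sub>L real)\<close>.
  Everything below tests such extensions on \<open>V i\<close> only, so the choice of extension is immaterial
  and the restriction map from the dual of \<open>'a\<close> to the dual of \<open>V i\<close> is not written.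
\<close>

definition energy_sublevel :: "('a \<Rightarrow> real) \<Rightarrow> 'a \<Rightarrow> 'a set" where
  "energy_sublevel E u0 = {v. E v \<le> E u0}"

definition twice_frechet ::
  "('a::real_normed_vector \<Rightarrow> real) \<Rightarrow> ('a \<Rightarrow> 'a \<Rightarrow>\<^sub>L real) \<Rightarrow> ('a \<Rightarrow> 'a \<Rightarrow>\<^sub>L 'a \<Rightarrow>\<^sub>L real) \<Rightarrow> bool" where
  "twice_frechet E E' E'' \<longleftrightarrow>
     (\<forall>v. (E has_derivative blinfun_apply (E' v)) (at v)) \<and>
     (\<forall>v. (E' has_derivative blinfun_apply (E'' v)) (at v))"

text \<open>The norm of the dual of the subspace \<open>W\<close>; the point \<open>v = 0\<close> contributes \<open>0 / 0 = 0\<close>, which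
  does not change the supremum and gives the value \<open>0\<close> for \<open>W = {0}\<close>.\<close>

definition dual_norm_on :: "'a::real_normed_vector set \<Rightarrow> ('a \<Rightarrow>\<^sub>L real) \<Rightarrow> real" where
  "dual_norm_on W f = (SUP v\<in>W. f v / norm v)"

text \<open>\<open>F\<close> is twice Frechet differentiable on \<open>W\<close>: the second derivative is that of \<open>F'\<close> as a map
  from \<open>W\<close> to the dual of \<open>W\<close>, with the remainder measured in the norm of the dual of \<open>W\<close>.\<close>

definition twice_frechet_on ::
  "'a::real_normed_vector set \<Rightarrow> ('a \<Rightarrow> real) \<Rightarrow> ('a \<Rightarrow> 'a \<Rightarrow>\<^sub>L real) \<Rightarrow>
     ('a \<Rightarrow> 'a \<Rightarrow>\<^sub>L 'a \<Rightarrow>\<^sub>L real) \<Rightarrow> bool" where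
  "twice_frechet_on W F F' F'' \<longleftrightarrow>
     (\<forall>x\<in>W. (F has_derivative blinfun_apply (F' x)) (at x within W)) \<and>
     (\<forall>x\<in>W. ((\<lambda>h. dual_norm_on W (F' (x + h) - F' x - F'' x h) / norm h) \<longlongrightarrow> 0)
               (at 0 within W))"

definition strongly_convex_deriv ::
  "real \<Rightarrow> ('a::real_normed_vector \<Rightarrow> 'a \<Rightarrow>\<^sub>L real) \<Rightarrow> bool" where
  "strongly_convex_deriv \<mu> E' \<longleftrightarrow>
     \<mu> > 0 \<and> (\<forall>v w. \<mu> * (norm (w - v))\<^sup>2 \<le> (E' w - E' v) (w - v))"

definition space_decomposition ::
  "nat \<Rightarrow> (nat \<Rightarrow> 'a::real_normed_vector set) \<Rightarrow> bool" where
  "space_decomposition N V \<longleftrightarrow>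
     (\<forall>i\<in>{1..N}. subspace (V i) \<and> closed (V i)) \<and>
     (\<forall>v. \<exists>vs. (\<forall>i\<in>{1..N}. vs i \<in> V i) \<and> v = (\<Sum>i=1..N. vs i))"

definition stable_decomposition ::
  "nat \<Rightarrow> (nat \<Rightarrow> 'a::real_normed_vector set) \<Rightarrow> real \<Rightarrow> bool" where
  "stable_decomposition N V CA \<longleftrightarrow>
     CA > 0 \<and>
     (\<forall>v. \<exists>vs. (\<forall>i\<in>{1..N}. vs i \<in> V i) \<and> v = (\<Sum>i=1..N. vs i) \<and>
               (\<Sum>i=1..N. (norm (vs i))\<^sup>2) \<le> CA\<^sup>2 * (norm v)\<^sup>2)"

definition strengthened_cauchy_schwarz ::
  "nat \<Rightarrow> (nat \<Rightarrow> 'a::real_normed_vector set) \<Rightarrow> 'a set \<Rightarrow> ('a \<Rightarrow> 'a \<Rightarrow>\<^sub>L real) \<Rightarrow> real \<Rightarrow> bool" where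
  "strengthened_cauchy_schwarz N V B E' CS \<longleftrightarrow>
     CS > 0 \<and>
     (\<forall>w u v.
        (\<forall>i\<in>{1..N}. \<forall>j\<in>{1..N}. w i j \<in> B \<and> w i j + u j \<in> B) \<and>
        (\<forall>j\<in>{1..N}. u j \<in> V j) \<and> (\<forall>i\<in>{1..N}. v i \<in> V i) \<longrightarrow>
        (\<Sum>i=1..N. \<Sum>j=i+1..N. (E' (w i j + u j) - E' (w i j)) (v i))
          \<le> CS * sqrt (\<Sum>i=1..N. (norm (u i))\<^sup>2) * sqrt (\<Sum>i=1..N. (norm (v i))\<^sup>2))"

definition linear_projection_onto :: "'a::real_vector set \<Rightarrow> ('a \<Rightarrow> 'a) \<Rightarrow> bool" where
  "linear_projection_onto W Q \<longleftrightarrow> linear Q \<and> (\<forall>v. Q v \<in> W) \<and> (\<forall>v\<in>W. Q v = v)"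

text \<open>\<open>F i\<close>, \<open>F' i\<close>, \<open>F'' i\<close> are the local energy on \<open>V i\<close> and its derivatives.\<close>

definition approximation_property ::
  "nat \<Rightarrow> (nat \<Rightarrow> 'a::real_normed_vector set) \<Rightarrow> (nat \<Rightarrow> 'a \<Rightarrow> 'a) \<Rightarrow> 'a set \<Rightarrow>
     ('a \<Rightarrow> real) \<Rightarrow> ('a \<Rightarrow> 'a \<Rightarrow>\<^sub>L real) \<Rightarrow> ('a \<Rightarrow> 'a \<Rightarrow>\<^sub>L 'a \<Rightarrow>\<^sub>L real) \<Rightarrow>
     (nat \<Rightarrow> 'a \<Rightarrow> real) \<Rightarrow> (nat \<Rightarrow> 'a \<Rightarrow> 'a \<Rightarrow>\<^sub>L real) \<Rightarrow>
     (nat \<Rightarrow> 'a \<Rightarrow> 'a \<Rightarrow>\<^sub>L 'a \<Rightarrow>\<^sub>L real) \<Rightarrow> real \<Rightarrow> bool" where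
  "approximation_property N V Q B E E' E'' F F' F'' \<epsilon> \<longleftrightarrow>
     twice_frechet E E' E'' \<and>
     (\<forall>i\<in>{1..N}. twice_frechet_on (V i) (F i) (F' i) (F'' i)) \<and>
     (\<forall>i\<in>{1..N}. \<forall>w\<in>B. \<forall>\<eta>\<in>V i. \<forall>u\<in>V i. \<forall>v\<in>V i.
        \<bar>E'' (w + \<eta>) u v - F'' i (Q i w + \<eta>) u v\<bar> \<le> \<epsilon> * norm u * norm v)"

text \<open>One subspace correction of the FAS scheme, taking \<open>v\<close> to \<open>v'\<close>. It is a relation, because the
  local problem only asks to find some solution \<open>\<eta>\<close>.\<close>

definition fas_correction ::
  "('a::real_normed_vector \<Rightarrow> 'a \<Rightarrow>\<^sub>L real) \<Rightarrow> 'a set \<Rightarrow> ('a \<Rightarrow> 'a) \<Rightarrow> ('a \<Rightarrow> 'a \<Rightarrow>\<^sub>L real) \<Rightarrow>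
     'a \<Rightarrow> 'a \<Rightarrow> bool" where
  "fas_correction E' W Q F' v v' \<longleftrightarrow>
     (let \<xi> = Q v; \<tau> = F' \<xi> - E' v in
      \<exists>\<eta>\<in>W. (\<forall>w\<in>W. F' \<eta> w = \<tau> w) \<and> v' = v + (\<eta> - \<xi>))"

definition fas_step ::
  "nat \<Rightarrow> (nat \<Rightarrow> 'a::real_normed_vector set) \<Rightarrow> (nat \<Rightarrow> 'a \<Rightarrow> 'a) \<Rightarrow> ('a \<Rightarrow> 'a \<Rightarrow>\<^sub>L real) \<Rightarrow>
     (nat \<Rightarrow> 'a \<Rightarrow> 'a \<Rightarrow>\<^sub>L real) \<Rightarrow> 'a \<Rightarrow> 'a \<Rightarrow> bool" where
  "fas_step N V Q E' F' x x' \<longleftrightarrow>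
     (\<exists>v. v 0 = x \<and> (\<forall>i\<in>{1..N}. fas_correction E' (V i) (Q i) (F' i) (v (i - 1)) (v i)) \<and> x' = v N)"

end

theory Submission
  imports Defs
begin

text \<open>
  Comparing the local problem with \<open>E\<close> along the segment from \<open>v\<close> to \<open>v + s\<close>, the approximation
  property shows that \<open>E' (v + s)\<close> has size at most \<open>\<epsilon> * norm s\<close> on the subspace. With strong
  convexity each correction lowers the energy by at least \<open>(\<mu> / 2 - \<epsilon>) * (norm s)\<^sup>2\<close>; in
  particular all intermediate points stay in the sublevel set. Conversely, testing \<open>E'\<close> at the new
  iterate with a stable decomposition of the error and telescoping over the later corrections
  bounds the energy error by \<open>(CS + \<epsilon>)\<^sup>2 * CA\<^sup>2 / (2 * \<mu>)\<close> times the sum of the \<open>(norm s)\<^sup>2\<close>.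
  The contraction follows by eliminating this sum.
\<close>

section \<open>Dual norms on a subspace, derivatives along lines, and convexity\<close>

text \<open>A real supremum bounds its terms only when the set is bounded above; the operator norm
  of the extension \<open>f\<close> provides that bound.\<close>

lemma dual_norm_on_bound:
  fixes f :: "'a::real_normed_vector \<Rightarrow>\<^sub>L real"
  assumes "w \<in> W"
  shows "f w \<le> dual_norm_on W f * norm w"
proof (cases "w = 0")
  case False
  have "f v / norm v \<le> norm f" for v
  proof (cases "v = 0")
    case False
    then show ?thesis
      using norm_blinfun[of f v] by (simp add: divide_simps)
  qed simp
  then have "bdd_above ((\<lambda>v. f v / norm v) ` W)"
    by (intro bdd_aboveI2)
  from cSUP_upper[OF assms this] have "f w / norm w \<le> dual_norm_on W f"
    by (simp add: dual_norm_on_def)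
  with False show ?thesis
    by (simp add: divide_simps)
qed simp

lemma dual_norm_on_bound_abs:
  fixes f :: "'a::real_normed_vector \<Rightarrow>\<^sub>L real"
  assumes "subspace W" "w \<in> W"
  shows "\<bar>f w\<bar> \<le> dual_norm_on W f * norm w"
  using dual_norm_on_bound[OF assms(2), of f]
    dual_norm_on_bound[OF subspace_neg[OF assms], of f]
  by (simp add: blinfun.minus_right)

text \<open>Evaluating the remainder in \<open>twice_frechet_on\<close> at a fixed \<open>w\<close>
  of \<open>W\<close>, and only for increments along \<open>s\<close>, leaves an ordinary real
  derivative, to which mean value estimates apply.\<close>

lemma twice_frechet_on_line_deriv:
  assumes F: "twice_frechet_on W F F' F''" and W: "subspace W"
    and x: "x \<in> W" and s: "s \<in> W" and w: "w \<in> W"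
  shows "((\<lambda>t. F' (x + t *\<^sub>R s) w) has_real_derivative F'' (x + t *\<^sub>R s) s w) (at t)"
proof (cases "s = 0")
  \<comment> \<open>Split off because the substitution of \<open>h\<close> times \<open>s\<close> in
    the limit at 0 within \<open>W\<close> requires nonzero increments.\<close>
  case True
  then show ?thesis
    by (simp add: blinfun.zero_right)
next
  case False
  define y where "y = x + t *\<^sub>R s"
  have y: "y \<in> W"
    unfolding y_def by (intro subspace_add subspace_scale W x s)
  define r where "r h = dual_norm_on W (F' (y + h) - F' y - F'' y h) / norm h" for h
  have "(r \<longlongrightarrow> 0) (at 0 within W)"
    using F y by (simp add: twice_frechet_on_def r_def[abs_def])
  moreover have "filterlim (\<lambda>h::real. h *\<^sub>R s) (at 0 within W) (at 0)"
    unfolding filterlim_at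
  proof
    show "\<forall>\<^sub>F h::real in at 0. h *\<^sub>R s \<in> W \<and> h *\<^sub>R s \<noteq> 0"
      using False subspace_scale[OF W s]
      by (auto simp: eventually_at intro: exI[of _ 1])
    show "((\<lambda>h::real. h *\<^sub>R s) \<longlongrightarrow> 0) (at 0)"
      by (rule tendsto_eq_intros refl | simp)+
  qed
  ultimately have "((\<lambda>h. r (h *\<^sub>R s)) \<longlongrightarrow> 0) (at 0)"
    by (rule filterlim_compose)
  then have lim: "((\<lambda>h. r (h *\<^sub>R s) * (norm s * norm w)) \<longlongrightarrow> 0) (at 0)"
    by (rule tendsto_mult_left_zero)
  have "\<forall>\<^sub>F h in at 0. norm ((F' (x + (t + h) *\<^sub>R s) w - F' (x + t *\<^sub>R s) w) / h - F'' y s w)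
      \<le> r (h *\<^sub>R s) * (norm s * norm w)"
    unfolding eventually_at_filter
  proof (rule always_eventually, intro allI impI)
    fix h :: real
    assume h: "h \<noteq> 0"
    have "(F' (x + (t + h) *\<^sub>R s) w - F' (x + t *\<^sub>R s) w) / h - F'' y s w
        = (F' (y + h *\<^sub>R s) - F' y - F'' y (h *\<^sub>R s)) w / h"
      using h by (simp add: y_def blinfun.diff_left blinfun.scaleR_left blinfun.scaleR_right
          scaleR_add_left add.assoc diff_divide_distrib)
    also have "norm \<dots> \<le> dual_norm_on W (F' (y + h *\<^sub>R s) - F' y - F'' y (h *\<^sub>R s)) * norm w / \<bar>h\<bar>"
      using dual_norm_on_bound_abs[OF W w] h by (simp add: divide_right_mono)
    also have "\<dots> = r (h *\<^sub>R s) * (norm s * norm w)"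
      using h False by (simp add: r_def)
    finally show "norm ((F' (x + (t + h) *\<^sub>R s) w - F' (x + t *\<^sub>R s) w) / h - F'' y s w)
      \<le> r (h *\<^sub>R s) * (norm s * norm w)" .
  qed
  then have "((\<lambda>h. (F' (x + (t + h) *\<^sub>R s) w - F' (x + t *\<^sub>R s) w) / h - F'' y s w) \<longlongrightarrow> 0) (at 0)"
    using lim by (rule Lim_null_comparison)
  then show ?thesis
    unfolding DERIV_def y_def by (rule Lim_null[THEN iffD2])
qed

lemma has_derivative_along_line:
  assumes "(f has_derivative f') (at (x + t *\<^sub>R s))"
  shows "((\<lambda>t. f (x + t *\<^sub>R s)) has_vector_derivative f' s) (at t)"
proof -
  interpret f': bounded_linear f'
    using assms by (rule has_derivative_bounded_linear)
  have "((\<lambda>t. x + t *\<^sub>R s) has_derivative (\<lambda>h. h *\<^sub>R s)) (at t)"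
    by (auto intro!: derivative_eq_intros)
  from has_derivative_compose[OF this assms] show ?thesis
    by (simp add: has_vector_derivative_def f'.scaleR)
qed

lemma twice_frechet_line_deriv:
  assumes "twice_frechet E E' E''"
  shows "((\<lambda>t. E (x + t *\<^sub>R s)) has_real_derivative E' (x + t *\<^sub>R s) s) (at t)"
    and "((\<lambda>t. E' (x + t *\<^sub>R s) w) has_real_derivative E'' (x + t *\<^sub>R s) s w) (at t)"
proof -
  show "((\<lambda>t. E (x + t *\<^sub>R s)) has_real_derivative E' (x + t *\<^sub>R s) s) (at t)"
    using assms unfolding has_real_derivative_iff_has_vector_derivative twice_frechet_def
    by (intro has_derivative_along_line) simp
  have "((\<lambda>y. E' y w) has_derivative (\<lambda>h. E'' (x + t *\<^sub>R s) h w)) (at (x + t *\<^sub>R s))"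
    using assms unfolding twice_frechet_def
    by (intro bounded_linear.has_derivative[OF blinfun.bounded_linear_left]) simp
  then show "((\<lambda>t. E' (x + t *\<^sub>R s) w) has_real_derivative E'' (x + t *\<^sub>R s) s w) (at t)"
    unfolding has_real_derivative_iff_has_vector_derivative
    by (rule has_derivative_along_line)
qed

text \<open>Subtracting the linear and quadratic terms from the energy along the segment leaves a
  function \<open>g\<close> whose derivative is nonnegative by strong monotonicity of
  \<open>E'\<close>.\<close>

lemma strongly_convex_lower_bound:
  assumes E: "twice_frechet E E' E''" and sc: "strongly_convex_deriv \<mu> E'"
  shows "E x + E' x y + \<mu> / 2 * (norm y)\<^sup>2 \<le> E (x + y)"
proof -
  define g where "g t = E (x + t *\<^sub>R y) - t * E' x y - \<mu> / 2 * (norm y)\<^sup>2 * t\<^sup>2" for t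
  have "g 0 \<le> g 1"
  proof (rule DERIV_nonneg_imp_nondecreasing[where f = g])
    fix t :: real
    assume t: "0 \<le> t"
    have "(g has_real_derivative E' (x + t *\<^sub>R y) y - E' x y - \<mu> * t * (norm y)\<^sup>2) (at t)"
      unfolding g_def
      by (auto intro!: derivative_eq_intros twice_frechet_line_deriv[OF E] simp: field_simps)
    moreover have "0 \<le> E' (x + t *\<^sub>R y) y - E' x y - \<mu> * t * (norm y)\<^sup>2"
    proof (cases "t = 0")
      case False
      \<comment> \<open>Monotonicity between \<open>x\<close> and the point at parameter
        \<open>t\<close> carries one factor \<open>t\<close> too many; it is cancelled for positive
        \<open>t\<close>.\<close>
      have "\<mu> * (norm (t *\<^sub>R y))\<^sup>2 \<le> (E' (x + t *\<^sub>R y) - E' x) (t *\<^sub>R y)"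
        using sc unfolding strongly_convex_deriv_def by (metis add_diff_cancel_left')
      then have "t * (\<mu> * t * (norm y)\<^sup>2) \<le> t * (E' (x + t *\<^sub>R y) y - E' x y)"
        by (simp add: blinfun.diff_left blinfun.scaleR_right power2_eq_square algebra_simps)
      with False t show ?thesis
        by (simp add: mult_le_cancel_left)
    qed simp
    ultimately show "\<exists>d. (g has_real_derivative d) (at t) \<and> 0 \<le> d"
      by blast
  qed simp
  then show ?thesis
    by (simp add: g_def)
qed

section \<open>A single subspace correction\<close>

lemma fas_correction_residual:
  assumes E: "twice_frechet E E' E''" and F: "twice_frechet_on W F F' F''"
    and W: "subspace W" and Q: "Q v \<in> W"
    and approx: "\<And>\<eta> a b. \<eta> \<in> W \<Longrightarrow> a \<in> W \<Longrightarrow> b \<in> W \<Longrightarrow>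
      \<bar>E'' (v + \<eta>) a b - F'' (Q v + \<eta>) a b\<bar> \<le> \<epsilon> * norm a * norm b"
    and step: "fas_correction E' W Q F' v v'"
  shows "v' - v \<in> W" and "\<And>w. w \<in> W \<Longrightarrow> \<bar>E' v' w\<bar> \<le> \<epsilon> * norm (v' - v) * norm w"
proof -
  from step obtain \<eta> where \<eta>: "\<eta> \<in> W" "\<And>w. w \<in> W \<Longrightarrow> F' \<eta> w = (F' (Q v) - E' v) w"
    and v': "v' = v + (\<eta> - Q v)"
    unfolding fas_correction_def Let_def by blast
  define s where "s = v' - v"
  have s: "s \<in> W"
    unfolding s_def v' using subspace_diff[OF W \<eta>(1) Q] by simp
  then show "v' - v \<in> W"
    by (simp add: s_def)
  fix w
  assume w: "w \<in> W"
  \<comment> \<open>The local equation makes the increment of \<open>g\<close> over [0, 1] equal to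
    \<open>E' v' w\<close>, since \<open>Q v + s\<close> is the local solution \<eta>. The
    approximation property, with t times \<open>s\<close> as its \<eta>, bounds the derivative of
    \<open>g\<close>.\<close>
  define g where "g t = E' (v + t *\<^sub>R s) w - F' (Q v + t *\<^sub>R s) w" for t
  have "norm (g 1 - g 0) \<le> (\<epsilon> * norm s * norm w) * norm (1 - 0 :: real)"
  proof (rule field_differentiable_bound[where S = UNIV])
    fix t :: real
    show "(g has_field_derivative E'' (v + t *\<^sub>R s) s w - F'' (Q v + t *\<^sub>R s) s w) (at t within UNIV)"
      unfolding g_def
      by (auto intro!: derivative_intros twice_frechet_line_deriv[OF E]
          twice_frechet_on_line_deriv[OF F W Q s w])
    show "norm (E'' (v + t *\<^sub>R s) s w - F'' (Q v + t *\<^sub>R s) s w) \<le> \<epsilon> * norm s * norm w"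
      using approx[OF subspace_scale[OF W s] s w] by simp
  qed auto
  moreover have "g 1 - g 0 = E' v' w"
    using \<eta>(2)[OF w] by (simp add: g_def s_def v' blinfun.diff_left)
  ultimately show "\<bar>E' v' w\<bar> \<le> \<epsilon> * norm (v' - v) * norm w"
    by (simp add: s_def)
qed

text \<open>Strong convexity is expanded at the new point \<open>v'\<close>, looking back to
  \<open>v\<close>, because the derivative in the direction of the correction is small
  there.\<close>

lemma fas_correction_energy_decrease:
  assumes E: "twice_frechet E E' E''" and sc: "strongly_convex_deriv \<mu> E'"
    and res: "\<bar>E' v' (v' - v)\<bar> \<le> \<epsilon> * norm (v' - v) * norm (v' - v)"
  shows "(\<mu> - 2 * \<epsilon>) / 2 * (norm (v' - v))\<^sup>2 \<le> E v - E v'"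
proof -
  have "E v' + E' v' (v - v') + \<mu> / 2 * (norm (v - v'))\<^sup>2 \<le> E v"
    using strongly_convex_lower_bound[OF E sc, of v' "v - v'"] by simp
  moreover have "E' v' (v - v') = - E' v' (v' - v)"
    by (simp add: blinfun.diff_right)
  moreover have "E' v' (v' - v) \<le> \<epsilon> * (norm (v' - v))\<^sup>2"
    using res by (simp add: power2_eq_square mult.assoc)
  ultimately show ?thesis
    by (simp add: norm_minus_commute left_diff_distrib diff_divide_distrib)
qed

section \<open>A full sweep and the contraction rate\<close>

text \<open>\<open>S\<close> is the sum of the squared norms of the corrections. Both bounds refer
  to the same \<open>S\<close>, so it can be eliminated afterwards.\<close>

lemma fas_step_energy_bounds:
  assumes dec: "space_decomposition N V"
    and Q: "\<forall>i\<in>{1..N}. linear_projection_onto (V i) (Q i)"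
    and stable: "stable_decomposition N V CA"
    and scs: "strengthened_cauchy_schwarz N V (energy_sublevel E u0) E' CS"
    and sc: "strongly_convex_deriv \<mu> E'"
    and \<epsilon>: "0 < \<epsilon>" "\<epsilon> < \<mu> / 2"
    and approx: "approximation_property N V Q (energy_sublevel E u0) E E' E'' F F' F'' \<epsilon>"
    and x: "x \<in> energy_sublevel E u0"
    and step: "fas_step N V Q E' F' x x'"
  obtains S where "0 \<le> S" and "(\<mu> - 2 * \<epsilon>) / 2 * S \<le> E x - E x'"
    and "\<And>u. E x' - E u \<le> (CS + \<epsilon>)\<^sup>2 * CA\<^sup>2 / (2 * \<mu>) * S"
proof -
  let ?B = "energy_sublevel E u0"
  have \<mu>: "\<mu> > 0" and CA: "CA > 0" and CS: "CS > 0"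
    using sc stable scs
    by (auto simp: strongly_convex_deriv_def stable_decomposition_def
        strengthened_cauchy_schwarz_def)
  have E: "twice_frechet E E' E''"
    using approx by (simp add: approximation_property_def)
  from step obtain v where v0: "v 0 = x" and vN: "x' = v N"
    and corr: "\<And>i. i \<in> {1..N} \<Longrightarrow> fas_correction E' (V i) (Q i) (F' i) (v (i - 1)) (v i)"
    unfolding fas_step_def by blast
  define s where "s i = v i - v (i - 1)" for i
  have residual: "s i \<in> V i \<and> (\<forall>w\<in>V i. \<bar>E' (v i) w\<bar> \<le> \<epsilon> * norm (s i) * norm w)"
    if i: "i \<in> {1..N}" and B: "v (i - 1) \<in> ?B" for i
  proof -
    have F: "twice_frechet_on (V i) (F i) (F' i) (F'' i)"
      using approx i by (simp add: approximation_property_def)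
    have W: "subspace (V i)"
      using dec i by (simp add: space_decomposition_def)
    have Qv: "Q i (v (i - 1)) \<in> V i"
      using Q i by (simp add: linear_projection_onto_def)
    have "\<bar>E'' (v (i - 1) + \<eta>) a b - F'' i (Q i (v (i - 1)) + \<eta>) a b\<bar> \<le> \<epsilon> * norm a * norm b"
      if "\<eta> \<in> V i" "a \<in> V i" "b \<in> V i" for \<eta> a b
      using approx i B that by (simp add: approximation_property_def)
    from fas_correction_residual[OF E F W Qv this corr[OF i]] show ?thesis
      by (auto simp: s_def)
  qed
  have decrease: "(\<mu> - 2 * \<epsilon>) / 2 * (norm (s i))\<^sup>2 \<le> E (v (i - 1)) - E (v i)"
    if "i \<in> {1..N}" "v (i - 1) \<in> ?B" for i
    using residual[OF that] unfolding s_def by (intro fas_correction_energy_decrease[OF E sc]) blast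
  \<comment> \<open>\<open>residual\<close> and \<open>decrease\<close> presuppose that the previous
    point lies in the sublevel set, where the approximation property holds; the decrease passes
    membership on to the next point.\<close>
  have inB: "n \<le> N \<Longrightarrow> v n \<in> ?B" for n
  proof (induction n)
    case 0
    then show ?case
      using v0 x by simp
  next
    case (Suc n)
    have "0 \<le> (\<mu> - 2 * \<epsilon>) / 2 * (norm (s (Suc n)))\<^sup>2"
      using \<epsilon> by (intro mult_nonneg_nonneg) auto
    also have "\<dots> \<le> E (v n) - E (v (Suc n))"
      using decrease[of "Suc n"] Suc by simp
    finally show ?case
      using Suc by (simp add: energy_sublevel_def)
  qed
  have B: "v (i - 1) \<in> ?B" "v i \<in> ?B" if "i \<in> {1..N}" for i
    using inB[of "i - 1"] inB[of i] that by auto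
  note residual = residual[OF _ B(1)] and decrease = decrease[OF _ B(1)]
  define S where "S = (\<Sum>i=1..N. (norm (s i))\<^sup>2)"
  have S: "0 \<le> S"
    unfolding S_def by (intro sum_nonneg) simp
  have "(\<mu> - 2 * \<epsilon>) / 2 * S \<le> (\<Sum>i=1..N. E (v (i - 1)) - E (v i))"
    unfolding S_def sum_distrib_left by (intro sum_mono decrease) auto
  also have "\<dots> = E x - E x'"
    using sum_telescope''[of 0 N "\<lambda>i. - E (v i)"] by (simp add: v0 vN)
  finally have lower: "(\<mu> - 2 * \<epsilon>) / 2 * S \<le> E x - E x'" .
  have upper: "E x' - E u \<le> (CS + \<epsilon>)\<^sup>2 * CA\<^sup>2 / (2 * \<mu>) * S" for u
  proof -
    define e where "e = x' - u"
    from stable obtain w where w: "\<And>i. i \<in> {1..N} \<Longrightarrow> w i \<in> V i"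
      and e: "e = (\<Sum>i=1..N. w i)" and "(\<Sum>i=1..N. (norm (w i))\<^sup>2) \<le> CA\<^sup>2 * (norm e)\<^sup>2"
      unfolding stable_decomposition_def by blast
    then have sqrt_w: "sqrt (\<Sum>i=1..N. (norm (w i))\<^sup>2) \<le> CA * norm e"
      using CA by (intro real_le_lsqrt) (auto simp: power_mult_distrib)
    \<comment> \<open>Telescoping from \<open>v i\<close> to \<open>v N\<close> separates the
      residual right after correction \<open>i\<close> from the effect of the later corrections,
      which has the form of the strengthened Cauchy-Schwarz sum.\<close>
    have tel: "E' x' (w i)
        = E' (v i) (w i) + (\<Sum>j=i+1..N. (E' (v (j - 1) + s j) - E' (v (j - 1))) (w i))"
      if "i \<in> {1..N}" for i
      using that sum_telescope''[of i N "\<lambda>j. E' (v j) (w i)"]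
      by (simp add: s_def vN blinfun.diff_left)
    have "E' x' e = (\<Sum>i=1..N. E' x' (w i))"
      unfolding e by (rule blinfun.sum_right)
    also have "\<dots> = (\<Sum>i=1..N. E' (v i) (w i))
        + (\<Sum>i=1..N. \<Sum>j=i+1..N. (E' (v (j - 1) + s j) - E' (v (j - 1))) (w i))"
      using tel by (simp add: sum.distrib)
    also have "(\<Sum>i=1..N. E' (v i) (w i)) \<le> (\<Sum>i=1..N. \<epsilon> * (norm (s i) * norm (w i)))"
      using residual w by (intro sum_mono) (force simp: abs_le_iff mult.assoc)
    also have "\<dots> \<le> \<epsilon> * (sqrt S * sqrt (\<Sum>i=1..N. (norm (w i))\<^sup>2))"
      using L2_set_mult_ineq[where A = "{1..N}" and f = "\<lambda>i. norm (s i)" and g = "\<lambda>i. norm (w i)"] \<epsilon>(1)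
      by (simp add: sum_distrib_left[symmetric] L2_set_def S_def)
    \<comment> \<open>The base point for the pair (i, j) is \<open>v (j - 1)\<close> for every i; it
      and \<open>v j\<close> both lie in the sublevel set, as the inequality demands.\<close>
    also have "(\<Sum>i=1..N. \<Sum>j=i+1..N. (E' (v (j - 1) + s j) - E' (v (j - 1))) (w i))
        \<le> CS * sqrt S * sqrt (\<Sum>i=1..N. (norm (w i))\<^sup>2)"
      unfolding S_def
      by (rule scs[unfolded strengthened_cauchy_schwarz_def, THEN conjunct2, rule_format,
            of "\<lambda>i j. v (j - 1)" s w]) (use residual w B in \<open>auto simp: s_def\<close>)
    finally have "E' x' e \<le> (CS + \<epsilon>) * sqrt S * sqrt (\<Sum>i=1..N. (norm (w i))\<^sup>2)"
      by (simp add: algebra_simps)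
    also have "\<dots> \<le> (CS + \<epsilon>) * sqrt S * (CA * norm e)"
      using CS \<epsilon> S sqrt_w by (intro mult_left_mono) auto
    finally have *: "E' x' e \<le> (CS + \<epsilon>) * CA * sqrt S * norm e"
      by (simp add: algebra_simps)
    have "E x' - E u \<le> E' x' e - \<mu> / 2 * (norm e)\<^sup>2"
      using strongly_convex_lower_bound[OF E sc, of x' "- e"]
      by (simp add: e_def blinfun.diff_right norm_minus_commute)
    also have "\<dots> \<le> (CS + \<epsilon>) * CA * sqrt S * norm e - \<mu> / 2 * (norm e)\<^sup>2"
      using * by simp
    \<comment> \<open>The right side is the maximum over t of c t - \<mu> / 2 times t squared, with
      c the coefficient of \<open>norm e\<close>; completing the square proves it.\<close>
    also have "\<dots> \<le> ((CS + \<epsilon>) * CA * sqrt S)\<^sup>2 / (2 * \<mu>)"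
    proof -
      let ?c = "(CS + \<epsilon>) * CA * sqrt S"
      have "0 \<le> (?c - \<mu> * norm e)\<^sup>2 / (2 * \<mu>)"
        using \<mu> by simp
      also have "\<dots> = ?c\<^sup>2 / (2 * \<mu>) - (?c * norm e - \<mu> / 2 * (norm e)\<^sup>2)"
        using \<mu> by (simp only: power2_diff) (simp add: field_simps power2_eq_square)
      finally show ?thesis
        by simp
    qed
    also have "\<dots> = (CS + \<epsilon>)\<^sup>2 * CA\<^sup>2 / (2 * \<mu>) * S"
      using S by (simp add: power_mult_distrib)
    finally show ?thesis .
  qed
  from S lower upper show ?thesis
    by (rule that)
qed

theorem corollary6p4:
  fixes E :: "'a::{real_inner, complete_space} \<Rightarrow> real"
    and E' :: "'a \<Rightarrow> 'a \<Rightarrow>\<^sub>L real"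
    and E'' :: "'a \<Rightarrow> 'a \<Rightarrow>\<^sub>L 'a \<Rightarrow>\<^sub>L real"
    and N :: nat
    and V :: "nat \<Rightarrow> 'a set"
    and Q :: "nat \<Rightarrow> 'a \<Rightarrow> 'a"
    and F :: "nat \<Rightarrow> 'a \<Rightarrow> real"
    and F' :: "nat \<Rightarrow> 'a \<Rightarrow> 'a \<Rightarrow>\<^sub>L real"
    and F'' :: "nat \<Rightarrow> 'a \<Rightarrow> 'a \<Rightarrow>\<^sub>L 'a \<Rightarrow>\<^sub>L real"
    and u0 u :: 'a
    and U :: "nat \<Rightarrow> 'a"
    and \<mu> L CA CS \<epsilon> :: real
    and k :: nat
  assumes "space_decomposition N V"
    and "\<forall>i\<in>{1..N}. linear_projection_onto (V i) (Q i)"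
    and "stable_decomposition N V CA"
    and "strengthened_cauchy_schwarz N V (energy_sublevel E u0) E' CS"
    and "strongly_convex_deriv \<mu> E'"
    and "L-lipschitz_on (energy_sublevel E u0) E'"
    and "0 < \<epsilon>" and "\<epsilon> < \<mu> / 2"
    and "approximation_property N V Q (energy_sublevel E u0) E E' E'' F F' F'' \<epsilon>"
    and "\<forall>v. E u \<le> E v"
    and "U 0 = u0"
    and "\<forall>n. fas_step N V Q E' F' (U n) (U (Suc n))"
  shows "E (U (Suc k)) - E u
    \<le> ((CS + \<epsilon>)\<^sup>2 * CA\<^sup>2) / ((CS + \<epsilon>)\<^sup>2 * CA\<^sup>2 + \<mu> * (\<mu> - 2 * \<epsilon>)) * (E (U k) - E u)"
proof -
  have \<mu>: "\<mu> > 0" and CA: "CA > 0" and CS: "CS > 0"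
    using assms(3-5)
    by (auto simp: strongly_convex_deriv_def stable_decomposition_def
        strengthened_cauchy_schwarz_def)
  note bounds = fas_step_energy_bounds[OF assms(1-5,7-9) _ assms(12)[rule_format]]
  \<comment> \<open>\<open>bounds\<close> applies only to iterates in the sublevel set; its decrease
    estimate keeps them there, starting from \<open>U 0 = u0\<close>.\<close>
  have inB: "U n \<in> energy_sublevel E u0" for n
  proof (induction n)
    case 0
    then show ?case
      using \<open>U 0 = u0\<close> by (simp add: energy_sublevel_def)
  next
    case (Suc n)
    from bounds[OF this] obtain S where "0 \<le> S"
      and S: "(\<mu> - 2 * \<epsilon>) / 2 * S \<le> E (U n) - E (U (Suc n))" .
    then have "0 \<le> (\<mu> - 2 * \<epsilon>) / 2 * S"
      using \<open>\<epsilon> < \<mu> / 2\<close> by (intro mult_nonneg_nonneg) auto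
    with S Suc show ?case
      by (simp add: energy_sublevel_def)
  qed
  define A where "A = (CS + \<epsilon>)\<^sup>2 * CA\<^sup>2"
  define m where "m = \<mu> - 2 * \<epsilon>"
  define d d' where "d = E (U k) - E u" and "d' = E (U (Suc k)) - E u"
  have A: "A > 0" and m: "m > 0"
    using CA CS assms(7,8) by (auto simp: A_def m_def)
  obtain S where lower: "m / 2 * S \<le> d - d'" and upper: "d' \<le> A / (2 * \<mu>) * S"
  proof (rule bounds[OF inB, of k])
    fix S
    assume "(\<mu> - 2 * \<epsilon>) / 2 * S \<le> E (U k) - E (U (Suc k))"
      and "\<And>u. E (U (Suc k)) - E u \<le> (CS + \<epsilon>)\<^sup>2 * CA\<^sup>2 / (2 * \<mu>) * S"
    then show thesis
      by (intro that[of S]) (simp_all add: A_def m_def d_def d'_def)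
  qed
  \<comment> \<open>The factor \<mu> times \<open>m\<close> turns the upper bound into
    \<open>A\<close> times the quantity \<open>m / 2 * S\<close> of the lower bound, so
    \<open>S\<close> drops out and solving for \<open>d'\<close> gives the rate.\<close>
  have "\<mu> * m * d' \<le> \<mu> * m * (A / (2 * \<mu>) * S)"
    using upper \<mu> m by (intro mult_left_mono) auto
  also have "\<dots> = A * (m / 2 * S)"
    using \<mu> by simp
  also have "\<dots> \<le> A * (d - d')"
    using lower A by (intro mult_left_mono) auto
  finally have "d' * (A + \<mu> * m) \<le> A * d"
    by (simp add: algebra_simps)
  moreover have "A + \<mu> * m > 0"
    using A \<mu> m by (simp add: add_pos_pos)
  ultimately have "d' \<le> A / (A + \<mu> * m) * d"
    by (simp add: field_simps)
  then show ?thesis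
    by (simp add: A_def m_def d_def d'_def)
qed

end
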